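(* There is an algorithm for MinSet under stochastic explorable uncertainty with deterministic right-hand sides whose competitive ratio is at most $\frac{2}{\tau}\cdot\rho(\gamma)$, where $\gamma=2/s_{\min}$, $s_{\min}=\min_{I_i\in\mathcal{I}:U_i-L_i>0}(U_i-L_i)$, and $\rho(\gamma)=\lceil\ln(\gamma\cdot m\cdot\max_{S\in\mathcal{S}}b_S)\rceil+\lceil\ln m\rceil$; i.e., $\mathbb{E}[\mathrm{ALG}]\le\frac{2}{\tau}\rho(\gamma)\,\mathbb{E}[\mathrm{OPT}]$ on every instance with balancing parameter $\tau>0$. This is $\mathcal{O}(\frac{1}{\tau}\log m)$ when the interval limits and right-hand sides are regarded as constants.
   Context: An instance of MinSet under stochastic explorable uncertainty with deterministic right-hand sides consists of intervals $\mathcal{I}=\{I_1,\dots,I_n\}$, each open $(L_i,U_i)$ with $L_i<U_i$ or trivial $\{w_i\}$ with $L_i=U_i=w_i$, a family $\mathcal{S}$ of $m$ subsets of $\mathcal{I}$, and known real right-hand sides $b_S$ for $S\in\mathcal{S}$. Each $I_i$ has a value $w_i\in I_i$, drawn independently according to a distribution unknown to the algorithm; let $a_i=w_i-L_i$, unknown until $I_i$ is queried (querying irrevocably adds $I_i$ to the solution and reveals $w_i$). The goal is to query a set $Q$ with $\sum_{I_i\in S\cap Q}a_i\ge b_S$ for all $S$, i.e. a feasible solution of the ILP $\min\sum_i x_i$ s.t. $\sum_{I_i\in S}a_ix_i\ge b_S$ $\forall S$, $x\in\{0,1\}^{\mathcal{I}}$; if no such set exists, the queried set must reduce the covering requirements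 as much as possible, i.e. satisfy $\max\{b_S-\sum_{I_i\in S\cap Q}a_i,0\}=\max\{b_S-\sum_{I_i\in S}a_i,0\}$ for all $S$. $\mathrm{ALG}$ is the number of queries of the algorithm and $\mathrm{OPT}$ the minimum cardinality of such a set for the realized values. For each $I_i$, $\tau_i=\Pr[w_i\ge(U_i+L_i)/2]$, and $\tau=\min_i\tau_i$.
   Formalization: The bound with ρ(γ) is proved when the first ceiling is ≥ 0 and ρ(γ) ≥ 1; in general ρ is replaced by max(1, max(0,⌈ln(γ m max b_S)⌉)+⌈ln m⌉), as the literal bound fails (m=1, interval (0,2), b=1 gives ρ=0 but OPT=1). Algorithms are adaptive query strategies. *)

theory Defs
  imports "HOL-Probability.Probability" "HOL-Library.Landau_Symbols"
begin

text \<open>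
  The part of an instance that is known to the algorithm. The intervals are indexed by
  \<open>{..<n_ivls I}\<close>, and a member of the family is a set of indices.
\<close>

record minset_instance =
  n_ivls :: nat
  lower :: "nat \<Rightarrow> real"
  upper :: "nat \<Rightarrow> real"
  family :: "nat set set"
  rhs :: "nat set \<Rightarrow> real"

definition valid_instance :: "minset_instance \<Rightarrow> bool" where
  "valid_instance I \<longleftrightarrow>
     (\<forall>i<n_ivls I. lower I i \<le> upper I i) \<and> family I \<subseteq> Pow {..<n_ivls I}"

definition uncertainty_interval :: "minset_instance \<Rightarrow> nat \<Rightarrow> real set" where
  "uncertainty_interval I i =
     (if lower I i < upper I i then {lower I i<..<upper I i} else {lower I i})"

definition realizations :: "minset_instance \<Rightarrow> (nat \<Rightarrow> real) set" where
  "realizations I = {w. \<forall>i<n_ivls I. w i \<in> uncertainty_interval I i}"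

definition coverage :: "minset_instance \<Rightarrow> (nat \<Rightarrow> real) \<Rightarrow> nat set \<Rightarrow> real" where
  "coverage I w T = (\<Sum>i\<in>T. w i - lower I i)"

definition covering :: "minset_instance \<Rightarrow> (nat \<Rightarrow> real) \<Rightarrow> nat set \<Rightarrow> bool" where
  "covering I w Q \<longleftrightarrow> (\<forall>S\<in>family I. coverage I w (S \<inter> Q) \<ge> rhs I S)"

definition is_solution :: "minset_instance \<Rightarrow> (nat \<Rightarrow> real) \<Rightarrow> nat set \<Rightarrow> bool" where
  "is_solution I w Q \<longleftrightarrow> Q \<subseteq> {..<n_ivls I} \<and>
     (if \<exists>Q'\<subseteq>{..<n_ivls I}. covering I w Q' then covering I w Q
      else \<forall>S\<in>family I. max (rhs I S - coverage I w (S \<inter> Q)) 0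
                        = max (rhs I S - coverage I w S) 0)"

definition OPT :: "minset_instance \<Rightarrow> (nat \<Rightarrow> real) \<Rightarrow> nat" where
  "OPT I w = Min (card ` {Q. is_solution I w Q})"

text \<open>
  A (deterministic, adaptive) algorithm sees the known part of the instance and the list of
  queries made so far together with the revealed values; it answers with the next query, or
  with \<^term>\<open>None\<close> to stop. It has no access to the distributions.
\<close>

type_synonym query_strategy = "minset_instance \<Rightarrow> (nat \<times> real) list \<Rightarrow> nat option"

definition query_algorithm :: "query_strategy \<Rightarrow> bool" where
  "query_algorithm A \<longleftrightarrow>
     (\<forall>I h i. A I h = Some i \<longrightarrow> i < n_ivls I \<and> i \<notin> fst ` set h)"

primrec history :: "query_strategy \<Rightarrow> minset_instance \<Rightarrow> (nat \<Rightarrow> real) \<Rightarrow> nat \<Rightarrow> (nat \<times> real) list"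
where
  "history A I w 0 = []"
| "history A I w (Suc k) =
     (case A I (history A I w k) of
        None \<Rightarrow> history A I w k
      | Some i \<Rightarrow> history A I w k @ [(i, w i)])"

text \<open>
  A query algorithm never repeats a query, so it has stopped after \<^term>\<open>n_ivls I\<close> rounds.
\<close>

definition queried :: "query_strategy \<Rightarrow> minset_instance \<Rightarrow> (nat \<Rightarrow> real) \<Rightarrow> nat set" where
  "queried A I w = fst ` set (history A I w (n_ivls I))"

definition ALG :: "query_strategy \<Rightarrow> minset_instance \<Rightarrow> (nat \<Rightarrow> real) \<Rightarrow> nat" where
  "ALG A I w = length (history A I w (n_ivls I))"

definition value_distributions :: "minset_instance \<Rightarrow> (nat \<Rightarrow> real measure) \<Rightarrow> bool" where
  "value_distributions I D \<longleftrightarrow>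
     (\<forall>i<n_ivls I. prob_space (D i) \<and> sets (D i) = sets borel \<and>
        (AE x in D i. x \<in> uncertainty_interval I i))"

definition joint :: "minset_instance \<Rightarrow> (nat \<Rightarrow> real measure) \<Rightarrow> (nat \<Rightarrow> real) measure" where
  "joint I D = PiM {..<n_ivls I} D"

definition tau :: "minset_instance \<Rightarrow> (nat \<Rightarrow> real measure) \<Rightarrow> real" where
  "tau I D =
     Min ((\<lambda>i. measure (D i) {x. x \<ge> (upper I i + lower I i) / 2}) ` {..<n_ivls I})"

text \<open>
  Integrability is required because the Bochner integral of a non-measurable function is
  \<open>0\<close>, which would make the inequality void.
\<close>

definition competitive_on ::
  "query_strategy \<Rightarrow> minset_instance \<Rightarrow> (nat \<Rightarrow> real measure) \<Rightarrow> real \<Rightarrow> bool" where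
  "competitive_on A I D r \<longleftrightarrow>
     integrable (joint I D) (\<lambda>w. real (ALG A I w)) \<and>
     (\<integral>w. real (ALG A I w) \<partial>joint I D) \<le> r * (\<integral>w. real (OPT I w) \<partial>joint I D)"

text \<open>
  If there is no non-trivial interval (or no constraint), \<open>s_min\<close> (or \<open>b_max\<close>) is an unspecified
  real; the empty set is then a solution for every realization, so that
  \<^term>\<open>OPT I w = 0\<close>.
\<close>

definition s_min :: "minset_instance \<Rightarrow> real" where
  "s_min I = Min {upper I i - lower I i | i. i < n_ivls I \<and> upper I i - lower I i > 0}"

definition b_max :: "minset_instance \<Rightarrow> real" where
  "b_max I = Max (rhs I ` family I)"

definition rho :: "real \<Rightarrow> nat \<Rightarrow> real \<Rightarrow> real" where
  "rho \<gamma> m b = of_int (\<lceil>ln (\<gamma> * real m * b)\<rceil> + \<lceil>ln (real m)\<rceil>)"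

text \<open>
  For small right-hand sides the logarithm is negative, and \<^term>\<open>rho\<close> can be \<open>\<le> 0\<close> although at
  least one query is necessary (take \<open>m = 1\<close> and \<open>b \<le> s_min / 2\<close>). The following variant replaces
  a negative first summand by \<open>0\<close> and a total below \<open>1\<close> by \<open>1\<close>; otherwise it is \<^term>\<open>rho\<close>.
\<close>

definition rho_trunc :: "real \<Rightarrow> nat \<Rightarrow> real \<Rightarrow> real" where
  "rho_trunc \<gamma> m b =
     max 1 (of_int (max 0 \<lceil>ln (\<gamma> * real m * b)\<rceil> + \<lceil>ln (real m)\<rceil>))"

end

theory Submission
  imports Defs
begin

text \<open>
  Write \<open>u\<^sub>i = U\<^sub>i - L\<^sub>i\<close>. The demand of a set \<open>S\<close> is its residual requirement, capped by the total
  width of its unqueried intervals; thanks to the cap, the unqueried part of every optimal solution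
  can pay for all demands (at widths) even if the instance is infeasible. The algorithm queries
  greedily with respect to the widths. Call a query of \<open>I\<^sub>i\<close> successful if \<open>a\<^sub>i \<ge> u\<^sub>i / 2\<close>.

  On each realization the number of successful queries is at most \<open>2 \<rho> OPT\<close>: while the total demand
  exceeds \<open>s_min / 2\<close>, a success multiplies it by at most \<open>1 - 1 / (2 OPT)\<close>; afterwards a success
  satisfies every set that contains the interval, and greedy set cover needs at most
  \<open>2 \<lceil>ln m\<rceil> OPT\<close> further successes. For \<open>m = 1\<close> the summand \<open>\<lceil>ln m\<rceil>\<close> vanishes, so this case
  needs its own rule (largest width first) and an exchange argument.

  Whether \<open>I\<^sub>i\<close> is queried does not depend on \<open>w\<^sub>i\<close>, so a query succeeds with probability at least
  \<open>\<tau>\<close> and the expected number of queries is at most \<open>1 / \<tau>\<close> times the expected number of successes.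
\<close>

section \<open>The greedy strategy\<close>

definition width :: "minset_instance \<Rightarrow> nat \<Rightarrow> real" where
  "width I i = upper I i - lower I i"

definition residual :: "minset_instance \<Rightarrow> (nat \<Rightarrow> real) \<Rightarrow> nat set \<Rightarrow> nat set \<Rightarrow> real" where
  "residual I w Q S = max 0 (rhs I S - coverage I w (S \<inter> Q))"

definition demand :: "minset_instance \<Rightarrow> (nat \<Rightarrow> real) \<Rightarrow> nat set \<Rightarrow> nat set \<Rightarrow> real" where
  "demand I w Q S = min (residual I w Q S) (\<Sum>i\<in>S - Q. width I i)"

definition total_demand :: "minset_instance \<Rightarrow> (nat \<Rightarrow> real) \<Rightarrow> nat set \<Rightarrow> real" where
  "total_demand I w Q = (\<Sum>S\<in>family I. demand I w Q S)"

definition active :: "minset_instance \<Rightarrow> (nat \<Rightarrow> real) \<Rightarrow> nat set \<Rightarrow> nat set set" where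
  "active I w Q = {S \<in> family I. demand I w Q S > 0}"

definition candidates :: "minset_instance \<Rightarrow> (nat \<Rightarrow> real) \<Rightarrow> nat set \<Rightarrow> nat set" where
  "candidates I w Q =
     {i. i < n_ivls I \<and> i \<notin> Q \<and> width I i > 0 \<and> (\<exists>S\<in>family I. i \<in> S \<and> demand I w Q S > 0)}"

text \<open>For one constraint the largest width wins. Otherwise, while much demand is left, a query
  is valued by the demand its width could pay for; afterwards it counts every active set once, as in
  greedy set cover.\<close>

definition gain :: "minset_instance \<Rightarrow> (nat \<Rightarrow> real) \<Rightarrow> nat set \<Rightarrow> nat \<Rightarrow> nat set \<Rightarrow> real" where
  "gain I w Q j S =
     (if card (family I) = 1 then width I j
      else if total_demand I w Q > s_min I / 2 then min (width I j) (demand I w Q S)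
      else of_bool (demand I w Q S > 0))"

definition score :: "minset_instance \<Rightarrow> (nat \<Rightarrow> real) \<Rightarrow> nat set \<Rightarrow> nat \<Rightarrow> real" where
  "score I w Q j = (\<Sum>S\<in>{S \<in> family I. j \<in> S}. gain I w Q j S)"

text \<open>Breaking ties by the least index makes the choice measurable in
  \<open>w\<close>.\<close>

definition next_query :: "minset_instance \<Rightarrow> (nat \<Rightarrow> real) \<Rightarrow> nat set \<Rightarrow> nat option" where
  "next_query I w Q =
     (if candidates I w Q = {} then None
      else Some (LEAST i. i \<in> candidates I w Q \<and>
                   (\<forall>j\<in>candidates I w Q. score I w Q j \<le> score I w Q i)))"

text \<open>Unqueried indices get the unspecified value \<open>the None\<close>; by
  \<open>next_query_cong\<close> it does not affect the choice.\<close>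

definition greedy :: query_strategy where
  "greedy I h = next_query I (\<lambda>i. the (map_of h i)) (fst ` set h)"

definition run :: "minset_instance \<Rightarrow> (nat \<Rightarrow> real) \<Rightarrow> nat \<Rightarrow> nat list" where
  "run I w k = map fst (history greedy I w k)"

section \<open>Nonanticipation and termination of the run\<close>

lemma next_query_SomeD:
  assumes "next_query I w Q = Some i"
  shows "i \<in> candidates I w Q" "\<And>j. j \<in> candidates I w Q \<Longrightarrow> score I w Q j \<le> score I w Q i"
proof -
  let ?C = "candidates I w Q"
  let ?P = "\<lambda>i. i \<in> ?C \<and> (\<forall>j\<in>?C. score I w Q j \<le> score I w Q i)"
  have ne: "?C \<noteq> {}" and i: "i = (LEAST i. ?P i)"
    using assms by (auto simp: next_query_def split: if_splits)
  have "finite ?C"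
    by (rule finite_subset[of _ "{..<n_ivls I}"]) (auto simp: candidates_def)
  then have "Max (score I w Q ` ?C) \<in> score I w Q ` ?C" using ne by simp
  then obtain x where "x \<in> ?C" "score I w Q x = Max (score I w Q ` ?C)" by force
  then have "?P x" using \<open>finite ?C\<close> by simp
  then have "?P i" unfolding i by (rule LeastI)
  then show "i \<in> ?C" "\<And>j. j \<in> ?C \<Longrightarrow> score I w Q j \<le> score I w Q i" by auto
qed

lemma next_query_NoneD: "next_query I w Q = None \<Longrightarrow> candidates I w Q = {}"
  by (auto simp: next_query_def split: if_splits)

text \<open>Only revealed values enter a demand, through \<open>coverage I w (S \<inter> Q)\<close>;
  the cap is a sum of widths, which are known in advance.\<close>

lemma demand_cong:
  assumes "\<And>i. i \<in> Q \<Longrightarrow> w i = w' i"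
  shows "demand I w Q = demand I w' Q"
proof -
  have "coverage I w (S \<inter> Q) = coverage I w' (S \<inter> Q)" for S
    unfolding coverage_def using assms by (intro sum.cong) auto
  then show ?thesis by (simp add: demand_def residual_def fun_eq_iff)
qed

lemma next_query_cong:
  assumes "\<And>i. i \<in> Q \<Longrightarrow> w i = w' i"
  shows "next_query I w Q = next_query I w' Q"
proof -
  have d: "demand I w Q = demand I w' Q" using assms by (rule demand_cong)
  then have "candidates I w Q = candidates I w' Q" by (simp add: candidates_def)
  moreover have "score I w Q = score I w' Q"
    unfolding score_def gain_def total_demand_def d ..
  ultimately show ?thesis by (simp add: next_query_def)
qed

lemma query_algorithm_greedy: "query_algorithm greedy"
  unfolding query_algorithm_def greedy_def
  by (force dest: next_query_SomeD(1) simp: candidates_def)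

lemma greedy_map: "greedy I (map (\<lambda>i. (i, w i)) q) = next_query I w (set q)"
  unfolding greedy_def
  by (simp add: image_image map_of_map_restrict, rule next_query_cong) simp

lemma history_eq: "history greedy I w k = map (\<lambda>i. (i, w i)) (run I w k)"
proof (induction k)
  case (Suc k)
  have "run I w (Suc k) = (case greedy I (history greedy I w k) of
      None \<Rightarrow> run I w k | Some i \<Rightarrow> run I w k @ [i])"
    by (simp add: run_def split: option.splits)
  then show ?case using Suc by (auto split: option.splits)
qed (simp add: run_def)

lemma run_0 [simp]: "run I w 0 = []"
  by (simp add: run_def)

lemma run_Suc:
  "run I w (Suc k) = (case next_query I w (set (run I w k)) of
      None \<Rightarrow> run I w k | Some i \<Rightarrow> run I w k @ [i])"
proof -
  have "greedy I (history greedy I w k) = next_query I w (set (run I w k))"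
    by (simp add: history_eq greedy_map)
  then show ?thesis by (simp add: run_def split: option.splits)
qed

lemma queried_greedy: "queried greedy I w = set (run I w (n_ivls I))"
  by (simp add: queried_def run_def)

lemma ALG_greedy: "ALG greedy I w = length (run I w (n_ivls I))"
  by (simp add: ALG_def run_def)

lemma run_distinct: "distinct (run I w k) \<and> set (run I w k) \<subseteq> {i. i < n_ivls I \<and> width I i > 0}"
  by (induction k)
    (auto simp: run_Suc candidates_def split: option.splits dest!: next_query_SomeD(1))

lemma run_stop_or_length:
  "next_query I w (set (run I w k)) = None \<or> length (run I w k) = k"
  by (induction k) (auto simp: run_Suc split: option.splits)

text \<open>A run that has not stopped after \<open>n_ivls I\<close> rounds has made that many
  distinct queries, so no index is left.\<close>

lemma candidates_final: "candidates I w (queried greedy I w) = {}"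
proof (cases "next_query I w (set (run I w (n_ivls I)))")
  case None
  then show ?thesis by (simp add: queried_greedy next_query_NoneD)
next
  case (Some i)
  let ?r = "run I w (n_ivls I)"
  have "card (set ?r) = n_ivls I"
    using Some run_stop_or_length[of I w "n_ivls I"] run_distinct[of I w "n_ivls I"]
    by (simp add: distinct_card)
  then have "set ?r = {..<n_ivls I}"
    using run_distinct[of I w "n_ivls I"] by (intro card_subset_eq) auto
  then show ?thesis by (auto simp: queried_greedy candidates_def)
qed

lemma ALG_greedy_eq_card: "ALG greedy I w = card (queried greedy I w)"
  using run_distinct[of I w "n_ivls I"] by (simp add: ALG_greedy queried_greedy distinct_card)

text \<open>If some summand reaches \<open>d\<close>, the right side is at least \<open>d\<close>;
  otherwise no cap on the right binds. In \<open>large_step\<close> this splits a demand into capped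
  widths of single intervals.\<close>

lemma min_sum_le_sum_min:
  fixes u :: "'a \<Rightarrow> real"
  assumes "finite A" "\<And>j. j \<in> A \<Longrightarrow> 0 \<le> u j" "0 \<le> d"
  shows "min (\<Sum>j\<in>A. u j) d \<le> (\<Sum>j\<in>A. min (u j) d)"
  using assms
proof (induction A rule: finite_induct)
  case (insert x A)
  have "0 \<le> (\<Sum>j\<in>A. u j)" using insert.prems by (intro sum_nonneg) auto
  moreover have "min (\<Sum>j\<in>A. u j) d \<le> (\<Sum>j\<in>A. min (u j) d)" "0 \<le> u x"
    using insert by auto
  ultimately show ?case
    using insert.hyps insert.prems(2) by (auto simp: min_def split: if_splits)
qed simp

lemma valid_instance_finite_family: "valid_instance I \<Longrightarrow> finite (family I)"
  by (auto simp: valid_instance_def intro: finite_subset)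

section \<open>Demands on a fixed realization\<close>

locale realized_instance =
  fixes I :: minset_instance and w :: "nat \<Rightarrow> real"
  assumes valid: "valid_instance I" and real: "w \<in> realizations I"
begin

lemma finite_family: "finite (family I)"
  using valid by (rule valid_instance_finite_family)

lemma family_lessD: "S \<in> family I \<Longrightarrow> i \<in> S \<Longrightarrow> i < n_ivls I"
  using valid by (auto simp: valid_instance_def)

lemma finite_member: "S \<in> family I \<Longrightarrow> finite S"
  using family_lessD by (meson bounded_nat_set_is_finite)

lemma width_nonneg: "i < n_ivls I \<Longrightarrow> width I i \<ge> 0"
  using valid by (auto simp: valid_instance_def width_def)

lemma value_bounds:
  assumes "i < n_ivls I"
  shows "0 \<le> w i - lower I i" "w i - lower I i \<le> width I i"
    "width I i > 0 \<Longrightarrow> 0 < w i - lower I i" "width I i > 0 \<Longrightarrow> w i - lower I i < width I i"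
proof -
  have "w i \<in> uncertainty_interval I i" "lower I i \<le> upper I i"
    using assms valid real by (auto simp: valid_instance_def realizations_def)
  then show "0 \<le> w i - lower I i" "w i - lower I i \<le> width I i"
    "width I i > 0 \<Longrightarrow> 0 < w i - lower I i" "width I i > 0 \<Longrightarrow> w i - lower I i < width I i"
    by (auto simp: uncertainty_interval_def width_def split: if_splits)
qed

lemma coverage_mono:
  assumes "S \<in> family I" "A \<subseteq> B" "B \<subseteq> S"
  shows "coverage I w A \<le> coverage I w B"
  unfolding coverage_def using assms finite_member[of S] family_lessD[of S] value_bounds(1)
  by (intro sum_mono2) (auto intro: finite_subset)

lemma coverage_le_width:
  assumes "S \<in> family I" "A \<subseteq> S"
  shows "coverage I w A \<le> (\<Sum>i\<in>A. width I i)"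
  unfolding coverage_def using assms family_lessD[of S] value_bounds(2) by (intro sum_mono) auto

lemma coverage_split:
  assumes "S \<in> family I"
  shows "coverage I w (S \<inter> A) = coverage I w (S \<inter> A \<inter> Q) + coverage I w (S \<inter> A - Q)"
  unfolding coverage_def using finite_member[OF assms] by (intro sum.Int_Diff) auto

lemma width_sum_nonneg: "S \<in> family I \<Longrightarrow> A \<subseteq> S \<Longrightarrow> 0 \<le> (\<Sum>i\<in>A. width I i)"
  using family_lessD width_nonneg by (intro sum_nonneg) blast

lemma demand_nonneg: "S \<in> family I \<Longrightarrow> 0 \<le> demand I w Q S"
  using width_sum_nonneg[of S "S - Q"] by (simp add: demand_def residual_def)

text \<open>The requirement drops by the revealed value, but the cap drops by the whole width,
  whatever the value is.\<close>

lemma demand_insert: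
  assumes S: "S \<in> family I" and i: "i \<in> S" "i \<notin> Q"
  shows "demand I w (insert i Q) S
    = min (max 0 (rhs I S - coverage I w (S \<inter> Q) - (w i - lower I i)))
          ((\<Sum>j\<in>S - Q. width I j) - width I i)"
proof -
  have fin: "finite S" using S by (rule finite_member)
  have "S \<inter> insert i Q = insert i (S \<inter> Q)" using i by auto
  then have 1: "coverage I w (S \<inter> insert i Q) = coverage I w (S \<inter> Q) + (w i - lower I i)"
    using fin i by (simp add: coverage_def)
  have "S - Q = insert i (S - insert i Q)" using i by auto
  then have "(\<Sum>j\<in>S - Q. width I j) = width I i + (\<Sum>j\<in>S - insert i Q. width I j)"
    using fin by (metis Diff_iff finite_Diff insertCI sum.insert)
  with 1 show ?thesis by (simp add: demand_def residual_def algebra_simps)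
qed

lemma demand_antimono_step:
  assumes S: "S \<in> family I" and i: "i < n_ivls I" "i \<notin> Q"
  shows "demand I w (insert i Q) S \<le> demand I w Q S"
proof (cases "i \<in> S")
  case True
  then show ?thesis
    using demand_insert[OF S True i(2)] value_bounds(1)[OF i(1)] width_nonneg[OF i(1)]
    by (auto simp: demand_def residual_def)
next
  case False
  then show ?thesis by (simp add: demand_def residual_def)
qed

text \<open>If the cap attains the minimum, it drops by the whole width. If the residual does, it
  drops by at least half the width or to 0, and the latter removes more than half of the demand or
  the demand was 0.\<close>

lemma demand_success:
  assumes S: "S \<in> family I" and i: "i \<in> S" "i \<notin> Q" and succ: "w i - lower I i \<ge> width I i / 2"
  shows "demand I w (insert i Q) S \<le> demand I w Q S - min (width I i) (demand I w Q S) / 2"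
  unfolding demand_insert[OF S i] unfolding demand_def residual_def
  using width_sum_nonneg[OF S Diff_subset, of Q] succ width_nonneg[OF family_lessD[OF S i(1)]]
  by (smt (verit) field_sum_of_halves)

text \<open>Since \<open>i\<close> itself contributes to the cap, a demand of at most half its width
  is the residual, and a success pays for that in full.\<close>

lemma demand_success_final:
  assumes S: "S \<in> family I" and i: "i \<in> S" "i \<notin> Q" and succ: "w i - lower I i \<ge> width I i / 2"
    and small: "demand I w Q S \<le> width I i / 2" and pos: "width I i > 0"
  shows "demand I w (insert i Q) S = 0"
proof -
  have "width I i \<le> (\<Sum>j\<in>S - Q. width I j)"
    using finite_member[OF S] i family_lessD[OF S] width_nonneg
    by (intro member_le_sum) auto
  then show ?thesis
    using succ small pos unfolding demand_insert[OF S i] unfolding demand_def residual_def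
    by linarith
qed

section \<open>Correctness of the output and structure of solutions\<close>

lemma candidates_empty_demand:
  assumes "candidates I w Q = {}" "S \<in> family I"
  shows "demand I w Q S = 0"
proof (rule ccontr)
  assume "\<not> ?thesis"
  then have *: "demand I w Q S > 0" using demand_nonneg[OF assms(2), of Q] by simp
  \<comment> \<open>A positive demand forces a positive cap, so an unqueried interval of positive
    width remains in \<open>S\<close>; it is a candidate.\<close>
  then have "(\<Sum>i\<in>S - Q. width I i) > 0" by (simp add: demand_def)
  then obtain i where "i \<in> S - Q" "width I i > 0"
    by (meson leD not_le_imp_less sum_nonpos)
  then have "i \<in> candidates I w Q"
    using assms(2) * family_lessD by (auto simp: candidates_def)
  with assms(1) show False by simp
qed

text \<open>Non-trivial intervals are open, so their values lie strictly above the lower limit; only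
  trivial intervals contribute nothing to the coverage.\<close>

lemma coverage_full:
  assumes S: "S \<in> family I"
  shows "coverage I w (S \<inter> Q) = coverage I w S \<longleftrightarrow> (\<forall>i\<in>S - Q. width I i = 0)"
proof -
  have "coverage I w S = coverage I w (S \<inter> Q) + coverage I w (S - Q)"
    using coverage_split[OF S, of S Q] by simp
  moreover have "coverage I w (S - Q) = 0 \<longleftrightarrow> (\<forall>i\<in>S - Q. w i - lower I i = 0)"
    unfolding coverage_def using finite_member[OF S] family_lessD[OF S] value_bounds(1)
    by (intro sum_nonneg_eq_0_iff) auto
  moreover have "w i - lower I i = 0 \<longleftrightarrow> width I i = 0" if "i \<in> S" for i
    using value_bounds[of i] width_nonneg[of i] family_lessD[OF S that] by force
  ultimately show ?thesis by auto
qed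

lemma is_solution_queried: "is_solution I w (queried greedy I w)"
proof -
  let ?Q = "queried greedy I w"
  have *: "rhs I S \<le> coverage I w (S \<inter> ?Q) \<or> coverage I w (S \<inter> ?Q) = coverage I w S"
    if S: "S \<in> family I" for S
  proof -
    \<comment> \<open>Either the residual is 0, or the cap is 0 and only trivial intervals of
      \<open>S\<close> are unqueried, so that the coverage is complete.\<close>
    have "demand I w ?Q S = 0"
      using candidates_final S by (rule candidates_empty_demand)
    then consider "residual I w ?Q S = 0" | "(\<Sum>i\<in>S - ?Q. width I i) = 0"
      by (auto simp: demand_def min_def split: if_splits)
    then show ?thesis
    proof cases
      case 2
      then have "\<forall>i\<in>S - ?Q. width I i = 0"
        using finite_member[OF S] family_lessD[OF S] width_nonneg
        by (subst (asm) sum_nonneg_eq_0_iff) auto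
      then show ?thesis using coverage_full[OF S] by simp
    qed (auto simp: residual_def max_def split: if_splits)
  qed
  have le: "coverage I w (S \<inter> Q) \<le> coverage I w S" if "S \<in> family I" for S Q
    using that by (rule coverage_mono) auto
  have sub: "?Q \<subseteq> {..<n_ivls I}"
    using run_distinct[of I w "n_ivls I"] by (auto simp: queried_greedy)
  show ?thesis
  proof (cases "\<exists>Q'\<subseteq>{..<n_ivls I}. covering I w Q'")
    case True
    then obtain Q' where "covering I w Q'" by blast
    \<comment> \<open>In the feasible case complete coverage meets the requirement too, so both
      alternatives of \<open>*\<close> suffice.\<close>
    then have "rhs I S \<le> coverage I w S" if "S \<in> family I" for S
      using that le[OF that, of Q'] by (force simp: covering_def)
    then have "covering I w ?Q" using * by (fastforce simp: covering_def)
    then show ?thesis using True sub by (simp add: is_solution_def)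
  next
    case False
    have "max (rhs I S - coverage I w (S \<inter> ?Q)) 0 = max (rhs I S - coverage I w S) 0"
      if "S \<in> family I" for S
      using *[OF that] le[OF that, of ?Q] by (auto simp: max_def)
    then show ?thesis using False sub by (simp add: is_solution_def)
  qed
qed

text \<open>Treats feasible and infeasible instances alike: if the truncated residuals of
  \<open>Q\<close> and of everything agree, they are both 0, or the coverages agree and
  \<open>coverage_full\<close> applies.\<close>

lemma is_solutionD:
  assumes "is_solution I w Q" and S: "S \<in> family I"
  shows "rhs I S \<le> coverage I w (S \<inter> Q) \<or> (\<forall>i\<in>S - Q. width I i = 0)"
proof (cases "\<exists>Q'\<subseteq>{..<n_ivls I}. covering I w Q'")
  case True
  then show ?thesis using assms by (simp add: is_solution_def covering_def)
next
  case False
  then have "max (rhs I S - coverage I w (S \<inter> Q)) 0 = max (rhs I S - coverage I w S) 0"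
    using assms by (simp add: is_solution_def)
  then show ?thesis using coverage_full[OF S, of Q] by (auto simp: max_def split: if_splits)
qed

lemma OPT_attained: "\<exists>Q. is_solution I w Q \<and> card Q = OPT I w"
proof -
  have "finite {Q. is_solution I w Q}"
    by (rule finite_subset[of _ "Pow {..<n_ivls I}"]) (auto simp: is_solution_def)
  then have "OPT I w \<in> card ` {Q. is_solution I w Q}"
    \<comment> \<open>The output of the greedy strategy shows that the minimum is over a nonempty
      set.\<close>
    unfolding OPT_def using is_solution_queried by (intro Min_in) auto
  then show ?thesis by auto
qed

section \<open>Progress of one successful query\<close>

definition success :: "nat \<Rightarrow> bool" where
  "success i \<longleftrightarrow> width I i / 2 \<le> w i - lower I i"

text \<open>If \<open>R\<close> meets the requirement of \<open>S\<close>, its unqueried part covers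
  the residual. If not, \<open>R\<close> contains all non-trivial intervals of \<open>S\<close>, and
  the bound is exactly the cap.\<close>

lemma demand_le_solution:
  assumes R: "is_solution I w R" and S: "S \<in> family I"
  shows "demand I w Q S \<le> (\<Sum>j\<in>S \<inter> R - Q. width I j)"
  using is_solutionD[OF R S]
proof
  assume "rhs I S \<le> coverage I w (S \<inter> R)"
  also have "\<dots> = coverage I w (S \<inter> R \<inter> Q) + coverage I w (S \<inter> R - Q)"
    using S by (rule coverage_split)
  also have "\<dots> \<le> coverage I w (S \<inter> Q) + (\<Sum>j\<in>S \<inter> R - Q. width I j)"
    by (intro add_mono coverage_mono[OF S] coverage_le_width[OF S]) auto
  finally show ?thesis
    using width_sum_nonneg[OF S, of "S \<inter> R - Q"] unfolding demand_def residual_def by fastforce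
next
  assume *: "\<forall>i\<in>S - R. width I i = 0"
  have "(\<Sum>j\<in>S - Q. width I j) = (\<Sum>j\<in>S \<inter> R - Q. width I j)"
    using finite_member[OF S] * by (intro sum.mono_neutral_right) auto
  then show ?thesis by (simp add: demand_def)
qed

text \<open>When \<open>S\<close> has positive demand, its unqueried intervals of positive width are
  candidates; the others add nothing to the sum.\<close>

lemma demand_le_candidates:
  assumes R: "is_solution I w R" and S: "S \<in> family I"
  shows "demand I w Q S \<le> (\<Sum>j\<in>S \<inter> (R \<inter> candidates I w Q). width I j)"
proof (cases "demand I w Q S > 0")
  case True
  have "(\<Sum>j\<in>S \<inter> R - Q. width I j) = (\<Sum>j\<in>S \<inter> (R \<inter> candidates I w Q). width I j)"
    using finite_member[OF S] family_lessD[OF S] S True width_nonneg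
    by (intro sum.mono_neutral_right) (auto simp: candidates_def less_le)
  then show ?thesis using demand_le_solution[OF R S, of Q] by simp
next
  case False
  then show ?thesis using width_sum_nonneg[OF S, of "S \<inter> (R \<inter> candidates I w Q)"] by auto
qed

lemma finite_solution: "is_solution I w R \<Longrightarrow> finite R"
  by (auto simp: is_solution_def intro: finite_subset)

lemma gain_nonneg: "S \<in> family I \<Longrightarrow> j \<in> S \<Longrightarrow> 0 \<le> gain I w Q j S"
  using width_nonneg[OF family_lessD] demand_nonneg by (simp add: gain_def)

lemma score_nonneg: "0 \<le> score I w Q j"
  unfolding score_def by (intro sum_nonneg) (auto intro: gain_nonneg)

text \<open>Averaging over \<open>R\<close>: interchanging the sums turns the gains that pay for the
  weights \<open>W\<close> into scores of candidates in \<open>R\<close>, and none of these exceeds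
  the score of the chosen \<open>i\<close>.\<close>

lemma next_query_score:
  assumes R: "is_solution I w R" and i: "next_query I w Q = Some i"
    and W: "\<And>S. S \<in> family I \<Longrightarrow>
      W S \<le> (\<Sum>j\<in>S \<inter> (R \<inter> candidates I w Q). gain I w Q j S)"
  shows "(\<Sum>S\<in>family I. W S) \<le> card R * score I w Q i"
proof -
  let ?T = "R \<inter> candidates I w Q"
  have fin: "finite ?T" using finite_solution[OF R] by simp
  have "(\<Sum>S\<in>family I. W S) \<le> (\<Sum>S\<in>family I. \<Sum>j\<in>S \<inter> ?T. gain I w Q j S)"
    by (intro sum_mono W)
  also have "\<dots> = (\<Sum>S\<in>family I. \<Sum>j | j \<in> ?T \<and> j \<in> S. gain I w Q j S)"
    by (intro sum.cong refl) auto
  also have "\<dots> = (\<Sum>j\<in>?T. score I w Q j)"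
    unfolding score_def by (rule sum.swap_restrict[OF finite_family fin])
  also have "\<dots> \<le> card ?T * score I w Q i"
    by (rule sum_bounded_above) (auto intro: next_query_SomeD(2)[OF i])
  also have "\<dots> \<le> card R * score I w Q i"
    using finite_solution[OF R] score_nonneg
    by (intro mult_right_mono) (auto intro: card_mono)
  finally show ?thesis .
qed

lemma total_demand_antimono_step:
  "i < n_ivls I \<Longrightarrow> i \<notin> Q \<Longrightarrow> total_demand I w (insert i Q) \<le> total_demand I w Q"
  unfolding total_demand_def by (intro sum_mono demand_antimono_step)

lemma active_antimono_step:
  "i < n_ivls I \<Longrightarrow> i \<notin> Q \<Longrightarrow> active I w (insert i Q) \<subseteq> active I w Q"
  unfolding active_def using demand_antimono_step by (auto intro: less_le_trans)

lemma finite_active: "finite (active I w Q)"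
  using finite_family by (simp add: active_def)

lemma s_min_props:
  assumes "i < n_ivls I" "width I i > 0"
  shows "s_min I > 0" "s_min I \<le> width I i"
proof -
  let ?A = "{upper I i - lower I i | i. i < n_ivls I \<and> upper I i - lower I i > 0}"
  have "?A \<subseteq> width I ` {..<n_ivls I}" by (auto simp: width_def)
  then have fin: "finite ?A" by (rule finite_subset) simp
  have mem: "width I i \<in> ?A" using assms by (auto simp: width_def)
  then have "Min ?A \<in> ?A" using fin by (intro Min_in) auto
  then show "s_min I > 0" by (auto simp: s_min_def)
  show "s_min I \<le> width I i" unfolding s_min_def using fin mem by (rule Min_le)
qed

text \<open>By averaging, the score of \<open>i\<close> is at least the total demand divided by
  \<open>card R\<close>; a success removes at least half of that score.\<close>

lemma large_step:
  assumes R: "is_solution I w R" and i: "next_query I w Q = Some i" and "card (family I) \<noteq> 1"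
    and large: "total_demand I w Q > s_min I / 2" and succ: "success i"
  shows "total_demand I w (insert i Q) \<le> total_demand I w Q * (1 - 1 / (2 * card R))"
proof -
  have g: "gain I w Q j S = min (width I j) (demand I w Q S)" for j S
    using assms by (simp add: gain_def)
  have i': "i \<in> candidates I w Q" using i by (rule next_query_SomeD)
  then have i'': "i < n_ivls I" "i \<notin> Q" "width I i > 0" by (auto simp: candidates_def)
  have avg: "total_demand I w Q \<le> card R * score I w Q i"
    unfolding total_demand_def
  proof (rule next_query_score[OF R i])
    fix S assume S: "S \<in> family I"
    let ?T = "S \<inter> (R \<inter> candidates I w Q)"
    have "demand I w Q S \<le> min (\<Sum>j\<in>?T. width I j) (demand I w Q S)"
      using demand_le_candidates[OF R S] by simp
    also have "\<dots> \<le> (\<Sum>j\<in>?T. gain I w Q j S)"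
      unfolding g using finite_member[OF S] family_lessD[OF S] width_nonneg demand_nonneg[OF S]
      by (intro min_sum_le_sum_min) auto
    finally show "demand I w Q S \<le> (\<Sum>j\<in>?T. gain I w Q j S)" .
  qed
  have "total_demand I w Q > 0" using large s_min_props(1)[OF i''(1,3)] by simp
  \<comment> \<open>An empty \<open>R\<close> would bound the positive total demand by 0.\<close>
  then have k: "card R > 0" using avg by (cases "card R = 0") auto
  have "total_demand I w (insert i Q)
      \<le> (\<Sum>S\<in>family I. demand I w Q S - (if i \<in> S then gain I w Q i S / 2 else 0))"
    unfolding total_demand_def
  proof (rule sum_mono)
    fix S assume S: "S \<in> family I"
    show "demand I w (insert i Q) S
        \<le> demand I w Q S - (if i \<in> S then gain I w Q i S / 2 else 0)"
      using demand_success[OF S _ i''(2)] demand_antimono_step[OF S i''(1,2)] succ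
      by (auto simp: g success_def)
  qed
  also have "\<dots> = total_demand I w Q - score I w Q i / 2"
    using finite_family
    by (simp add: total_demand_def score_def sum_subtractf sum_divide_distrib sum.If_cases Int_def)
  also have "\<dots> \<le> total_demand I w Q * (1 - 1 / (2 * card R))"
    using avg k by (simp add: field_simps)
  finally show ?thesis .
qed

text \<open>Each demand is now at most \<open>s_min I / 2\<close>, hence at most half the width of
  \<open>i\<close>, so a success deactivates every set containing \<open>i\<close>. By averaging
  these are at least a \<open>1 / card R\<close> fraction of the active sets.\<close>

lemma small_step:
  assumes R: "is_solution I w R" and i: "next_query I w Q = Some i" and "card (family I) \<noteq> 1"
    and small: "total_demand I w Q \<le> s_min I / 2" and succ: "success i"
  shows "card (active I w (insert i Q)) \<le> card (active I w Q) * (1 - 1 / real (card R))"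
proof -
  have g: "gain I w Q j S = of_bool (demand I w Q S > 0)" for j S
    using assms by (simp add: gain_def)
  have i': "i \<in> candidates I w Q" using i by (rule next_query_SomeD)
  then have i'': "i < n_ivls I" "i \<notin> Q" "width I i > 0" by (auto simp: candidates_def)
  have act: "active I w Q \<noteq> {}" using i' by (auto simp: candidates_def active_def)
  have card_act: "card (active I w Q) = (\<Sum>S\<in>family I. of_bool (demand I w Q S > 0) :: real)"
    using finite_family by (simp add: active_def Int_def)
  have avg: "card (active I w Q) \<le> card R * score I w Q i"
    unfolding card_act
  proof (rule next_query_score[OF R i])
    fix S assume S: "S \<in> family I"
    let ?T = "S \<inter> (R \<inter> candidates I w Q)"
    show "of_bool (demand I w Q S > 0) \<le> (\<Sum>j\<in>?T. gain I w Q j S)"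
    proof (cases "demand I w Q S > 0")
      case True
      \<comment> \<open>A positive demand is paid for by the widths over \<open>?T\<close>, so some
        candidate of \<open>R\<close> hits \<open>S\<close>.\<close>
      then have "?T \<noteq> {}" using demand_le_candidates[OF R S, of Q] by auto
      then have "card ?T \<noteq> 0" using finite_member[OF S] by auto
      then show ?thesis using True by (simp add: g)
    qed (simp add: g)
  qed
  have "card (active I w Q) > 0" using act finite_active by (simp add: card_gt_0_iff)
  then have k: "card R > 0" using avg by (cases "card R = 0") auto
  let ?X = "{S \<in> active I w Q. i \<in> S}"
  have "demand I w (insert i Q) S = 0" if "S \<in> ?X" for S
  proof -
    have S: "S \<in> family I" "i \<in> S" using that by (auto simp: active_def)
    have "demand I w Q S \<le> total_demand I w Q"
      unfolding total_demand_def using S finite_family demand_nonneg by (intro member_le_sum) auto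
    then show ?thesis
      using demand_success_final[OF S i''(2)] succ small s_min_props(2)[OF i''(1,3)] i''(3)
      by (simp add: success_def)
  qed
  then have "active I w (insert i Q) \<subseteq> active I w Q - ?X"
    using active_antimono_step[OF i''(1,2)] by (auto simp: active_def)
  then have "card (active I w (insert i Q)) \<le> card (active I w Q - ?X)"
    using finite_active by (intro card_mono) auto
  also have "\<dots> = card (active I w Q) - card ?X"
    using finite_active by (intro card_Diff_subset) auto
  finally have "real (card (active I w (insert i Q))) \<le> real (card (active I w Q)) - card ?X"
    using card_mono[OF finite_active, of ?X Q] by fastforce
  also have "real (card ?X) = score I w Q i"
  proof -
    have "{S \<in> family I. i \<in> S} \<inter> {S. 0 < demand I w Q S} = ?X" by (auto simp: active_def)
    then show ?thesis using finite_family by (simp add: score_def g)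
  qed
  also have "card (active I w Q) - score I w Q i \<le> card (active I w Q) * (1 - 1 / real (card R))"
    using avg k by (simp add: field_simps)
  finally show ?thesis .
qed

section \<open>Counting successes; the case of a single constraint\<close>

definition successes :: "nat \<Rightarrow> nat" where
  "successes t = card {i \<in> set (run I w t). success i}"

lemma successes_0 [simp]: "successes 0 = 0"
  by (simp add: successes_def)

lemma successes_Suc_Some:
  assumes "next_query I w (set (run I w t)) = Some i"
  shows "successes (Suc t) = successes t + of_bool (success i)"
    "set (run I w (Suc t)) = insert i (set (run I w t))"
proof -
  show *: "set (run I w (Suc t)) = insert i (set (run I w t))"
    using assms by (simp add: run_Suc)
  have "i \<notin> set (run I w t)"
    using next_query_SomeD(1)[OF assms] by (simp add: candidates_def)
  moreover have "{j \<in> insert i A. success j} =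
      (if success i then insert i {j \<in> A. success j} else {j \<in> A. success j})" for A
    by auto
  ultimately show "successes (Suc t) = successes t + of_bool (success i)"
    by (simp add: successes_def *)
qed

lemma run_Suc_None:
  "next_query I w (set (run I w t)) = None \<Longrightarrow> run I w (Suc t) = run I w t"
  by (simp add: run_Suc)

lemma candidates_antimono_step:
  assumes "i < n_ivls I" "i \<notin> Q"
  shows "candidates I w (insert i Q) \<subseteq> candidates I w Q"
  using demand_antimono_step[OF _ assms] unfolding candidates_def
  by (fastforce intro: less_le_trans)

text \<open>The score is the width here and the set of candidates only shrinks, so every query stays
  at least as wide as all later candidates.\<close>

lemma single_run_widths:
  assumes F: "family I = {S}"
  shows "set (run I w t) \<subseteq> S \<and>
    (\<forall>z\<in>set (run I w t). \<forall>j\<in>candidates I w (set (run I w t)). width I j \<le> width I z)"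
proof (induction t)
  case (Suc t)
  let ?Q = "set (run I w t)"
  show ?case
  proof (cases "next_query I w ?Q")
    case None
    then show ?thesis using Suc by (simp add: run_Suc_None)
  next
    case (Some i)
    have i: "i \<in> candidates I w ?Q" using Some by (rule next_query_SomeD)
    then have i': "i < n_ivls I" "i \<notin> ?Q" "i \<in> S" by (auto simp: candidates_def F)
    have "score I w ?Q j = width I j" if "j \<in> candidates I w ?Q" for j
    proof -
      have "{S' \<in> {S}. j \<in> S'} = {S}" using that by (auto simp: candidates_def F)
      then show ?thesis by (simp add: score_def gain_def F)
    qed
    then have "width I j \<le> width I i" if "j \<in> candidates I w ?Q" for j
      using next_query_SomeD(2)[OF Some that] i that by simp
    then show ?thesis
      using Suc candidates_antimono_step[OF i'(1,2)] i'(3) by (auto simp: successes_Suc_Some(2)[OF Some])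
  qed
qed simp

text \<open>
  Every successful query outside a solution contributes at least half of the width of every
  candidate in the solution, so two of them pay for one element of the solution.
\<close>

lemma single_successes:
  assumes F: "family I = {S}" and R: "is_solution I w R"
  shows "successes t \<le> 2 * card R"
proof (induction t)
  case (Suc t)
  let ?Q = "set (run I w t)"
  have S: "S \<in> family I" by (simp add: F)
  show ?case
  proof (cases "next_query I w ?Q")
    case None
    then show ?thesis using Suc by (simp add: run_Suc_None successes_def)
  next
    case (Some i)
    have i: "i \<in> candidates I w ?Q" using Some by (rule next_query_SomeD)
    have dem: "demand I w ?Q S > 0" using i by (auto simp: candidates_def F)
    have finR: "finite R" using R by (rule finite_solution)
    have QS: "?Q \<subseteq> S" using single_run_widths[OF F] by blast
    let ?Z = "{i \<in> ?Q. success i}"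
    from is_solutionD[OF R S] show ?thesis
    proof
      assume full: "\<forall>i\<in>S - R. width I i = 0"
      \<comment> \<open>Outside \<open>R\<close> the set \<open>S\<close> has only trivial
        intervals, and these are never queried.\<close>
      have "set (run I w (Suc t)) \<subseteq> R"
        using full single_run_widths[OF F, of "Suc t"] run_distinct[of I w "Suc t"] by force
      then have "successes (Suc t) \<le> card R"
        unfolding successes_def using finR by (intro card_mono) auto
      then show ?thesis by simp
    next
      assume feas: "rhs I S \<le> coverage I w (S \<inter> R)"
      let ?T = "R \<inter> candidates I w ?Q"
      have finT: "finite ?T" using finR by simp
      \<comment> \<open>Another query is about to be made, so the requirement is still unmet,
        whereas \<open>R\<close> meets it.\<close>
      have "coverage I w (S \<inter> ?Q) < rhs I S" using dem by (simp add: demand_def residual_def less_max_iff_disj)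
      with feas have lt: "coverage I w (S \<inter> ?Q) < coverage I w (S \<inter> R)" by simp
      have "coverage I w (S \<inter> R - ?Q) = coverage I w ?T"
        unfolding coverage_def
      proof (rule sum.mono_neutral_right)
        show "?T \<subseteq> S \<inter> R - ?Q" by (auto simp: candidates_def F)
        show "\<forall>j\<in>S \<inter> R - ?Q - ?T. w j - lower I j = 0"
        proof
          fix j assume j: "j \<in> S \<inter> R - ?Q - ?T"
          then have "j < n_ivls I" using family_lessD[OF S] by auto
          moreover from this have "width I j = 0"
            using j dem width_nonneg[of j] by (auto simp: candidates_def F less_le)
          ultimately show "w j - lower I j = 0" using value_bounds(1,2)[of j] by simp
        qed
      qed (use finite_member[OF S] in auto)
      moreover have "coverage I w (S \<inter> R \<inter> ?Q) = coverage I w (S \<inter> ?Q \<inter> R)"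
        by (simp add: Int_ac)
      \<comment> \<open>The part common to \<open>?Q\<close> and \<open>R\<close> cancels: the
        queries outside \<open>R\<close> cover strictly less than the remaining candidates of
        \<open>R\<close>.\<close>
      ultimately have lt': "coverage I w (S \<inter> ?Q - R) < coverage I w ?T"
        using lt coverage_split[OF S, of ?Q R] coverage_split[OF S, of R ?Q] by simp
      have nnQ: "0 \<le> coverage I w (S \<inter> ?Q - R)"
        unfolding coverage_def using value_bounds(1) family_lessD[OF S] by (intro sum_nonneg) auto
      have "?T \<noteq> {}" using lt' nnQ by (auto simp: coverage_def)
      then have "Max (width I ` ?T) \<in> width I ` ?T" using finT by (intro Max_in) auto
      then obtain r where "r \<in> ?T" "width I r = Max (width I ` ?T)" by force
      then have r: "r \<in> ?T" "\<And>j. j \<in> ?T \<Longrightarrow> width I j \<le> width I r"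
        using finT by (auto intro: Max_ge)
      have rpos: "width I r > 0" using r(1) by (auto simp: candidates_def)
      have "card (?Z - R) * (width I r / 2) \<le> (\<Sum>z\<in>?Z - R. w z - lower I z)"
      proof (rule sum_bounded_below)
        fix z assume z: "z \<in> ?Z - R"
        then have "width I r \<le> width I z" using single_run_widths[OF F, of t] r(1) by auto
        then show "width I r / 2 \<le> w z - lower I z" using z by (simp add: success_def)
      qed
      also have "\<dots> \<le> coverage I w (S \<inter> ?Q - R)"
        unfolding coverage_def using QS value_bounds(1) family_lessD[OF S]
        by (intro sum_mono2) auto
      also have "\<dots> < coverage I w ?T" by (rule lt')
      also have "\<dots> \<le> card ?T * width I r"
        unfolding coverage_def
      proof (rule sum_bounded_above)
        fix j assume "j \<in> ?T"
        then show "w j - lower I j \<le> width I r"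
          using r(2)[of j] value_bounds(2)[of j] by (auto simp: candidates_def)
      qed
      finally have "real (card (?Z - R)) < 2 * card ?T" using rpos by (simp add: field_simps)
      \<comment> \<open>The strictness makes room for the new query: \<open>successes t\<close> is
        at most \<open>card (?Z \<inter> R) + 2 * card ?T - 1\<close>, hence at most
        \<open>2 * card R - 1\<close>.\<close>
      then have 1: "card (?Z - R) < 2 * card ?T" by linarith
      have "card (?Z \<inter> R) + card ?T = card (?Z \<inter> R \<union> ?T)"
        using finR by (intro card_Un_disjoint[symmetric]) (auto simp: candidates_def)
      also have "\<dots> \<le> card R" using finR by (intro card_mono) auto
      finally have 2: "card (?Z \<inter> R) + card ?T \<le> card R" .
      have "card ?T \<le> card R" using finR by (intro card_mono) auto
      moreover have "successes t = card (?Z \<inter> R) + card (?Z - R)"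
        unfolding successes_def by (rule card_Int_Diff) simp
      ultimately show ?thesis using 1 2 successes_Suc_Some(1)[OF Some] by simp
    qed
  qed
qed simp

section \<open>Counting successes for several constraints\<close>

lemma demand_le_b_max:
  assumes "S \<in> family I" "b_max I \<ge> 0"
  shows "demand I w {} S \<le> b_max I"
proof -
  have "rhs I S \<le> b_max I" unfolding b_max_def using finite_family assms by (intro Max_ge) auto
  then show ?thesis
    using assms(2) by (auto simp: demand_def residual_def coverage_def min_le_iff_disj)
qed

text \<open>Write \<open>k = card R\<close>. In the first phase the total demand starts at no more
  than \<open>m * b_max I\<close> and shrinks by \<open>exp (- 1 / (2 * k))\<close> per success; in
  the second the number of active sets shrinks by \<open>exp (- 1 / k)\<close>. The second bound is
  counted from the full budget \<open>2 * k * L\<close> of the first phase, so it stays valid if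
  that phase ends early.\<close>

lemma multiple_invariant:
  fixes m :: nat and L :: int
  assumes R: "is_solution I w R" and k: "card R > 0"
    and m: "m = card (family I)" "m \<ge> 2" and b: "b_max I > 0" and s: "s_min I > 0"
    and L: "L = max 0 \<lceil>ln (2 / s_min I * real m * b_max I)\<rceil>"
  shows "(total_demand I w (set (run I w t)) > s_min I / 2 \<longrightarrow>
        total_demand I w (set (run I w t))
          \<le> real m * b_max I * exp (- real (successes t) / (2 * real (card R)))) \<and>
    (total_demand I w (set (run I w t)) \<le> s_min I / 2 \<longrightarrow>
        real (card (active I w (set (run I w t)))) \<le> real m *
          exp (- (real (successes t) - 2 * real (card R) * real_of_int L) / real (card R))) \<and>
    int (successes t) \<le> 2 * int (card R) * (L + \<lceil>ln m\<rceil>)"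
proof (induction t)
  case 0
  have Lnn: "L \<ge> 0" by (simp add: L)
  have "total_demand I w {} \<le> card (family I) * b_max I"
    unfolding total_demand_def using demand_le_b_max b by (intro sum_bounded_above) auto
  moreover have "real (card (active I w {})) \<le> real m * exp (2 * real_of_int L)"
  proof -
    have "real (card (active I w {})) \<le> real m * 1"
      using card_mono[OF finite_family, of "active I w {}"] by (simp add: m(1) active_def)
    also have "\<dots> \<le> real m * exp (2 * real_of_int L)" using Lnn by (intro mult_left_mono) auto
    finally show ?thesis .
  qed
  moreover have "0 \<le> ln m" using m(2) by simp
  then have "0 \<le> \<lceil>ln m\<rceil>" by linarith
  ultimately show ?case using k Lnn by (simp add: m(1))
next
  case (Suc t)
  let ?Q = "set (run I w t)"
  let ?k = "real (card R)"
  have Lnn: "L \<ge> 0" by (simp add: L)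
  have k1: "?k \<ge> 1" using k by simp
  have "0 < ln m" using m(2) by simp
  then have lnm: "1 \<le> \<lceil>ln m\<rceil>" by linarith
  show ?case
  proof (cases "next_query I w ?Q")
    case None
    then show ?thesis using Suc by (simp add: run_Suc_None successes_def)
  next
    case (Some i)
    have i: "i \<in> candidates I w ?Q" using Some by (rule next_query_SomeD)
    then have i': "i < n_ivls I" "i \<notin> ?Q" by (auto simp: candidates_def)
    have m1: "card (family I) \<noteq> 1" using m by simp
    note run = successes_Suc_Some[OF Some]
    have N: "successes (Suc t) \<le> successes t + 1" using run(1) by simp
    have mono: "total_demand I w (insert i ?Q) \<le> total_demand I w ?Q"
      using i' by (rule total_demand_antimono_step)
    have nn: "0 \<le> total_demand I w ?Q"
      unfolding total_demand_def using demand_nonneg by (intro sum_nonneg)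
    show ?thesis
    proof (cases "total_demand I w ?Q > s_min I / 2")
      case True
      then have IH: "total_demand I w ?Q \<le> real m * b_max I * exp (- real (successes t) / (2 * ?k))"
        using Suc by simp
      have "s_min I / 2 < real m * b_max I * exp (- real (successes t) / (2 * ?k))" using True IH by simp
      then have "exp (real (successes t) / (2 * ?k)) < 2 / s_min I * m * b_max I"
        using s by (simp add: exp_minus field_simps)
      then have "real (successes t) / (2 * ?k) < ln (2 / s_min I * m * b_max I)"
        using s b m by (subst exp_less_cancel_iff[symmetric], subst exp_ln) auto
      also have "\<dots> \<le> real_of_int L" unfolding L by linarith
      finally have "real (successes t) < 2 * ?k * real_of_int L" using k1 by (simp add: field_simps)
      then have "real_of_int (int (successes t)) < real_of_int (2 * int (card R) * L)" by simp
      \<comment> \<open>Both sides of the strict inequality are integers, as \<open>L\<close> is a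
        rounded logarithm; this absorbs the query of \<open>i\<close>.\<close>
      then have "int (successes t) + 1 \<le> 2 * int (card R) * L" by linarith
      then have N': "int (successes (Suc t)) \<le> 2 * int (card R) * L" using N by linarith
      then have C: "int (successes (Suc t)) \<le> 2 * int (card R) * (L + \<lceil>ln m\<rceil>)"
        using lnm by (simp add: distrib_left add_increasing2)
      have "real_of_int (int (successes (Suc t))) \<le> real_of_int (2 * int (card R) * L)"
        using N' by linarith
      then have Nr: "real (successes (Suc t)) \<le> 2 * ?k * real_of_int L" by simp
      \<comment> \<open>This query may end the first phase. The trivial bound \<open>m\<close>
        suffices, because the budget is not exceeded and the exponent is thus nonnegative.\<close>
      have B: "real (card (active I w (insert i ?Q)))
          \<le> real m * exp (- (real (successes (Suc t)) - 2 * ?k * real_of_int L) / ?k)"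
      proof -
        have "real (card (active I w (insert i ?Q))) \<le> real m * 1"
          using card_mono[OF finite_family, of "active I w (insert i ?Q)"]
          by (simp add: m(1) active_def)
        also have "\<dots> \<le> real m * exp (- (real (successes (Suc t)) - 2 * ?k * real_of_int L) / ?k)"
          using Nr k1 by (intro mult_left_mono) auto
        finally show ?thesis .
      qed
      have A: "total_demand I w (insert i ?Q)
          \<le> real m * b_max I * exp (- real (successes (Suc t)) / (2 * ?k))"
      proof (cases "success i")
        case succ: True
        have "total_demand I w (insert i ?Q) \<le> total_demand I w ?Q * (1 - 1 / (2 * ?k))"
          using large_step[OF R Some m1 True succ] by simp
        also have "\<dots> \<le> total_demand I w ?Q * exp (- (1 / (2 * ?k)))"
          using nn exp_ge_add_one_self[of "- (1 / (2 * ?k))"] by (intro mult_left_mono) auto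
        also have "\<dots> \<le> real m * b_max I * exp (- real (successes t) / (2 * ?k)) * exp (- (1 / (2 * ?k)))"
          using IH by (intro mult_right_mono) auto
        also have "\<dots> = real m * b_max I * exp (- real (successes (Suc t)) / (2 * ?k))"
          using succ run(1) k1 by (simp add: mult.assoc flip: exp_add) (simp add: field_simps)
        finally show ?thesis .
      next
        case False
        then show ?thesis using IH mono run(1) by simp
      qed
      show ?thesis unfolding run(2) using A B C by simp
    next
      case False
      then have small: "total_demand I w ?Q \<le> s_min I / 2" by simp
      then have IH: "real (card (active I w ?Q)) \<le> real m * exp (- (real (successes t) - 2 * ?k * real_of_int L) / ?k)"
        using Suc by simp
      have "active I w ?Q \<noteq> {}" using i by (auto simp: candidates_def active_def)
      \<comment> \<open>The candidate \<open>i\<close> lies in an active set, so the exponential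
        bound cannot have fallen below 1; this limits the successes so far.\<close>
      then have "1 \<le> real (card (active I w ?Q))" using finite_active by (simp add: Suc_le_eq card_gt_0_iff)
      then have "1 \<le> real m * exp (- (real (successes t) - 2 * ?k * real_of_int L) / ?k)" using IH by linarith
      then have "1 \<le> real m * inverse (exp ((real (successes t) - 2 * ?k * real_of_int L) / ?k))"
        by (simp only: minus_divide_left[symmetric] exp_minus)
      then have "exp ((real (successes t) - 2 * ?k * real_of_int L) / ?k) \<le> m"
        by (simp add: inverse_eq_divide le_divide_eq)
      then have "(real (successes t) - 2 * ?k * real_of_int L) / ?k \<le> ln m"
        using m(2) by (subst exp_le_cancel_iff[symmetric], subst exp_ln) auto
      then have "real (successes t) - 2 * ?k * real_of_int L \<le> ?k * ln m" using k1 by (simp add: field_simps)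
      also have "\<dots> \<le> ?k * real_of_int \<lceil>ln m\<rceil>" using k1 by (intro mult_left_mono) auto
      finally have "real (successes t) \<le> 2 * ?k * real_of_int L + ?k * real_of_int \<lceil>ln m\<rceil>" by simp
      \<comment> \<open>The second phase costs \<open>k * \<lceil>ln m\<rceil>\<close> plus one last
        query, which a second copy of this term absorbs. It is at least 1 because
        \<open>m \<ge> 2\<close>.\<close>
      moreover have "1 * 1 \<le> ?k * real_of_int \<lceil>ln m\<rceil>" using k1 lnm by (intro mult_mono) auto
      ultimately have "real (successes (Suc t)) \<le> 2 * ?k * (real_of_int L + real_of_int \<lceil>ln m\<rceil>)"
        using N by (simp add: algebra_simps)
      then have "real_of_int (int (successes (Suc t)))
          \<le> real_of_int (2 * int (card R) * (L + \<lceil>ln m\<rceil>))" by simp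
      then have C: "int (successes (Suc t)) \<le> 2 * int (card R) * (L + \<lceil>ln m\<rceil>)" by linarith
      have B: "real (card (active I w (insert i ?Q)))
          \<le> real m * exp (- (real (successes (Suc t)) - 2 * ?k * real_of_int L) / ?k)"
      proof (cases "success i")
        case succ: True
        have "real (card (active I w (insert i ?Q))) \<le> real (card (active I w ?Q)) * (1 - 1 / ?k)"
          using small_step[OF R Some m1 small succ] by simp
        also have "\<dots> \<le> real (card (active I w ?Q)) * exp (- (1 / ?k))"
          using exp_ge_add_one_self[of "- (1 / ?k)"] by (intro mult_left_mono) auto
        also have "\<dots> \<le> real m * exp (- (real (successes t) - 2 * ?k * real_of_int L) / ?k) * exp (- (1 / ?k))"
          using IH by (intro mult_right_mono) auto
        also have "\<dots> = real m * exp (- (real (successes (Suc t)) - 2 * ?k * real_of_int L) / ?k)"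
          using succ run(1) k1 by (simp add: mult.assoc flip: exp_add) (simp add: field_simps)
        finally show ?thesis .
      next
        case False
        have "card (active I w (insert i ?Q)) \<le> card (active I w ?Q)"
          using finite_active active_antimono_step[OF i'] by (rule card_mono)
        then show ?thesis using IH False run(1) by simp
      qed
      show ?thesis unfolding run(2) using small mono B C by simp
    qed
  qed
qed

lemma run_empty: "candidates I w {} = {} \<Longrightarrow> run I w t = []"
  by (induction t) (auto simp: run_Suc next_query_def)

lemma successes_le:
  assumes R: "is_solution I w R"
  shows "successes t \<le> 2 * rho_trunc (2 / s_min I) (card (family I)) (b_max I) * card R"
proof (cases "candidates I w {} = {}")
  \<comment> \<open>Nothing is ever queried. All instances with unspecified \<open>s_min\<close> or
    \<open>b_max\<close> fall here; in the other case both are positive, and so is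
    \<open>card R\<close>.\<close>
  case True
  then have "successes t = 0" by (simp add: successes_def run_empty)
  moreover have "rho_trunc (2 / s_min I) (card (family I)) (b_max I) \<ge> 1" by (simp add: rho_trunc_def)
  ultimately show ?thesis by simp
next
  case False
  let ?r = "rho_trunc (2 / s_min I) (card (family I)) (b_max I)"
  let ?m = "card (family I)"
  obtain i S where i: "i < n_ivls I" "width I i > 0" "S \<in> family I" "demand I w {} S > 0"
    using False by (auto simp: candidates_def)
  have s: "s_min I > 0" using s_min_props i by blast
  have "rhs I S > 0"
    using i(4) by (simp add: demand_def residual_def coverage_def less_max_iff_disj)
  moreover have "rhs I S \<le> b_max I" unfolding b_max_def using finite_family i by (intro Max_ge) auto
  ultimately have b: "b_max I > 0" by simp
  have "R \<noteq> {}" using demand_le_candidates[OF R i(3), of "{}"] i(4) by auto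
  then have k: "card R > 0" using finite_solution[OF R] by (simp add: card_gt_0_iff)
  have "?m \<noteq> 0" using i(3) finite_family by auto
  then consider "?m = 1" | "?m \<ge> 2" by linarith
  then show ?thesis
  proof cases
    case 1
    then obtain S where F: "family I = {S}" by (rule card_1_singletonE)
    \<comment> \<open>For one constraint the lower bound 1 on \<open>rho_trunc\<close> is
      enough.\<close>
    have "real (successes t) \<le> 2 * 1 * real (card R)" using single_successes[OF F R, of t] by simp
    also have "\<dots> \<le> 2 * ?r * card R"
      by (intro mult_right_mono mult_left_mono) (auto simp: rho_trunc_def)
    finally show ?thesis .
  next
    case 2
    let ?L = "max 0 \<lceil>ln (2 / s_min I * ?m * b_max I)\<rceil> + \<lceil>ln ?m\<rceil>"
    have "int (successes t) \<le> 2 * int (card R) * ?L"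
      using multiple_invariant[OF R k refl 2 b s refl, of t] by blast
    then have "real_of_int (int (successes t)) \<le> real_of_int (2 * int (card R) * ?L)" by linarith
    also have "\<dots> = 2 * real_of_int ?L * card R" by simp
    also have "\<dots> \<le> 2 * ?r * card R"
      by (intro mult_right_mono mult_left_mono) (auto simp: rho_trunc_def)
    finally show ?thesis by simp
  qed
qed

lemma successes_le_OPT:
  "card {i \<in> queried greedy I w. (upper I i + lower I i) / 2 \<le> w i}
     \<le> 2 * rho_trunc (2 / s_min I) (card (family I)) (b_max I) * OPT I w"
proof -
  \<comment> \<open>The event in the definition of \<open>tau\<close> is exactly the success of
    \<open>i\<close>.\<close>
  have "(upper I i + lower I i) / 2 \<le> w i \<longleftrightarrow> success i" for i
    by (auto simp: success_def width_def field_simps)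
  then show ?thesis
    using OPT_attained successes_le[of _ "n_ivls I"]
    by (metis (no_types, lifting) Collect_cong successes_def queried_greedy)
qed

lemma OPT_le: "OPT I w \<le> n_ivls I"
proof -
  obtain R where R: "is_solution I w R" "card R = OPT I w" using OPT_attained by blast
  then have "R \<subseteq> {..<n_ivls I}" by (simp add: is_solution_def)
  then show ?thesis using R(2) card_mono[of "{..<n_ivls I}" R] by simp
qed

end

text \<open>The decision to query an interval is made before its value is revealed.\<close>

lemma mem_run_cong:
  assumes "\<And>j. j \<noteq> i \<Longrightarrow> w j = w' j"
  shows "i \<in> set (run I w k) \<longleftrightarrow> i \<in> set (run I w' k)"
proof -
  \<comment> \<open>Strengthened for induction: the two runs coincide until \<open>i\<close> is
    queried, and then \<open>i\<close> belongs to both forever.\<close>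
  have "(i \<notin> set (run I w k) \<and> run I w k = run I w' k) \<or>
      (i \<in> set (run I w k) \<and> i \<in> set (run I w' k))"
  proof (induction k)
    case (Suc k)
    then show ?case
    proof
      assume *: "i \<notin> set (run I w k) \<and> run I w k = run I w' k"
      then have "next_query I w (set (run I w k)) = next_query I w' (set (run I w k))"
        using assms by (intro next_query_cong) metis
      with * show ?case by (auto simp: run_Suc split: option.splits)
    next
      assume "i \<in> set (run I w k) \<and> i \<in> set (run I w' k)"
      then show ?case by (auto simp: run_Suc split: option.splits)
    qed
  qed simp
  then show ?thesis by metis
qed

section \<open>Measurability and independence\<close>

lemma measurable_PiM_coordinate:
  assumes "\<And>i. i \<in> J \<Longrightarrow> sets (D i) = sets borel"
  shows "(\<lambda>w. w i) \<in> borel_measurable (PiM J D)"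
proof (cases "i \<in> J")
  case True
  then have "(\<lambda>w. w i) \<in> measurable (PiM J D) (D i)" by (rule measurable_component_singleton)
  then show ?thesis
    unfolding measurable_cong_sets[OF refl assms[OF True], of "PiM J D"] .
next
  case False
  \<comment> \<open>Points of the product space are extensional, so a coordinate outside
    \<open>J\<close> is constant.\<close>
  then have "w i = undefined" if "w \<in> space (PiM J D)" for w
    using that by (simp add: space_PiM PiE_def extensional_def)
  then show ?thesis
    using measurable_cong[of "PiM J D" "\<lambda>w. w i" "\<lambda>w. undefined" borel] by simp
qed

context
  fixes M :: "(nat \<Rightarrow> real) measure" and I :: minset_instance
  assumes coord [measurable]: "\<And>i. (\<lambda>w. w i) \<in> borel_measurable M"
    and valid: "valid_instance I"
begin

lemma measurable_coverage [measurable]: "(\<lambda>w. coverage I w T) \<in> borel_measurable M"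
  unfolding coverage_def by measurable

lemma measurable_demand [measurable]: "(\<lambda>w. demand I w Q S) \<in> borel_measurable M"
  unfolding demand_def residual_def by measurable

lemma measurable_total_demand [measurable]: "(\<lambda>w. total_demand I w Q) \<in> borel_measurable M"
  unfolding total_demand_def by measurable

lemma pred_candidates [measurable]: "Measurable.pred M (\<lambda>w. i \<in> candidates I w Q)"
proof -
  have "Measurable.pred M (\<lambda>w. \<exists>S\<in>family I. i \<in> S \<and> demand I w Q S > 0)"
    using valid_instance_finite_family[OF valid] by (intro pred_intros_finite(4)) auto
  then show ?thesis unfolding candidates_def mem_Collect_eq by measurable
qed

lemma measurable_score [measurable]: "(\<lambda>w. score I w Q j) \<in> borel_measurable M"
  unfolding score_def gain_def by measurable

lemma measurable_next_query [measurable]: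
  "(\<lambda>w. next_query I w Q) \<in> measurable M (count_space UNIV)"
proof -
  have [measurable]: "Measurable.pred M (\<lambda>w. candidates I w Q = {})"
    unfolding set_eq_iff by measurable
  have [measurable]: "Measurable.pred M (\<lambda>w. score I w Q j \<le> score I w Q i)" for i j
    unfolding pred_def by measurable
  have [measurable]: "Measurable.pred M (\<lambda>w. i \<in> candidates I w Q \<and>
      (\<forall>j\<in>candidates I w Q. score I w Q j \<le> score I w Q i))" for i
    unfolding Ball_def by measurable
  show ?thesis unfolding next_query_def by measurable
qed

lemma measurable_run [measurable]: "(\<lambda>w. run I w k) \<in> measurable M (count_space UNIV)"
proof (induction k)
  case (Suc k)
  let ?f = "\<lambda>q w. case next_query I w (set q) of None \<Rightarrow> q | Some i \<Rightarrow> q @ [i]"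
  have "?f q \<in> measurable M (count_space UNIV)" for q
    by measurable
  \<comment> \<open>There are only countably many lists of indices, so the next query may be treated
    with the run so far held fixed.\<close>
  from measurable_compose_countable[where f = ?f, OF this Suc]
  show ?case by (simp only: run_Suc)
qed simp

lemma pred_queried [measurable]: "Measurable.pred M (\<lambda>w. i \<in> queried greedy I w)"
  unfolding queried_greedy
  by (rule measurable_compose[OF measurable_run, of "\<lambda>q. i \<in> set q"]) simp

lemma pred_is_solution [measurable]: "Measurable.pred M (\<lambda>w. is_solution I w Q)"
proof -
  have fam: "Measurable.pred M (\<lambda>w. \<forall>S\<in>family I. P S w)"
    if "\<And>S. Measurable.pred M (P S)" for P
    using valid_instance_finite_family[OF valid] that by (intro pred_intros_finite(3)) auto
  have cov [measurable]: "Measurable.pred M (\<lambda>w. covering I w Q)" for Q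
    unfolding covering_def by (intro fam) measurable
  have "(\<exists>Q'\<subseteq>{..<n_ivls I}. covering I w Q') \<longleftrightarrow> (\<exists>Q'\<in>Pow {..<n_ivls I}. covering I w Q')" for w
    by auto
  moreover have "Measurable.pred M (\<lambda>w. \<exists>Q'\<in>Pow {..<n_ivls I}. covering I w Q')"
    by (intro pred_intros_finite(4)) auto
  ultimately have [measurable]: "Measurable.pred M (\<lambda>w. \<exists>Q'\<subseteq>{..<n_ivls I}. covering I w Q')"
    by simp
  have [measurable]: "Measurable.pred M (\<lambda>w. \<forall>S\<in>family I.
      max (rhs I S - coverage I w (S \<inter> Q)) 0 = max (rhs I S - coverage I w S) 0)"
    by (intro fam, unfold pred_def) measurable
  show ?thesis unfolding is_solution_def by measurable
qed

text \<open>\<open>OPT\<close> is a function of the set of all solutions, which takes finitely many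
  values, each described by finitely many measurable events.\<close>

lemma measurable_OPT [measurable]: "(\<lambda>w. real (OPT I w)) \<in> borel_measurable M"
proof -
  let ?P = "Pow {..<n_ivls I}"
  have sub: "Q \<in> ?P" if "is_solution I w Q" for w Q
    using that by (simp add: is_solution_def)
  have "(\<lambda>w. {Q. is_solution I w Q}) \<in> measurable M (count_space (Pow ?P))"
  proof (subst measurable_count_space_eq2)
    show "(\<lambda>w. {Q. is_solution I w Q}) \<in> space M \<rightarrow> Pow ?P \<and>
      (\<forall>a\<in>Pow ?P. (\<lambda>w. {Q. is_solution I w Q}) -` {a} \<inter> space M \<in> sets M)"
    proof (intro conjI ballI)
      fix a assume a: "a \<in> Pow ?P"
      have "{Q. is_solution I w Q} = a \<longleftrightarrow> (\<forall>Q\<in>?P. is_solution I w Q \<longleftrightarrow> Q \<in> a)" for w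
        using a sub[of w] by blast
      then have "(\<lambda>w. {Q. is_solution I w Q}) -` {a} \<inter> space M
          = {w \<in> space M. \<forall>Q\<in>?P. is_solution I w Q \<longleftrightarrow> Q \<in> a}"
        by (simp add: vimage_def Int_def conj_commute)
      also have "\<dots> \<in> sets M"
      proof -
        have "Measurable.pred M (\<lambda>w. \<forall>Q\<in>?P. is_solution I w Q \<longleftrightarrow> Q \<in> a)"
          by (rule pred_intros_finite(3)) (simp, measurable)
        then show ?thesis by (simp add: pred_def)
      qed
      finally show "(\<lambda>w. {Q. is_solution I w Q}) -` {a} \<inter> space M \<in> sets M" .
    qed (use sub in blast)
  qed simp
  from measurable_compose[where g = "\<lambda>X. real (Min (card ` X))" and L = borel, OF this]
  show ?thesis by (simp add: OPT_def)
qed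

end

text \<open>By Fubini: \<open>E\<close> ignores coordinate \<open>i\<close>, so the inner integral
  over that coordinate factors into the indicator of \<open>E\<close> and the measure of
  \<open>B\<close>.\<close>

lemma emeasure_PiM_indep_component:
  fixes M :: "'i \<Rightarrow> 'a measure"
  assumes prob: "\<And>i. prob_space (M i)" and fin: "finite J" and i: "i \<in> J"
    and E: "E \<in> sets (PiM J M)" and B: "B \<in> sets (M i)"
    and inv: "\<And>x y. x \<in> space (PiM J M) \<Longrightarrow> y \<in> space (M i) \<Longrightarrow> x(i := y) \<in> E \<longleftrightarrow> x \<in> E"
  shows "emeasure (PiM J M) {x \<in> E. x i \<in> B} = emeasure (PiM J M) E * emeasure (M i) B"
proof -
  interpret product_sigma_finite M
    using prob by (simp add: product_sigma_finite_def prob_space_imp_sigma_finite)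
  let ?J = "J - {i}"
  have J: "insert i ?J = J" using i by auto
  \<comment> \<open>An arbitrary filler for coordinate \<open>i\<close>, used to test membership in
    \<open>E\<close>.\<close>
  obtain y0 where y0: "y0 \<in> space (M i)" using prob_space.not_empty[OF prob[of i]] by blast
  have upd: "x(i := y) \<in> space (PiM J M)" if "x \<in> space (PiM ?J M)" "y \<in> space (M i)" for x y
    using that i by (auto simp: space_PiM PiE_iff extensional_def split: if_splits)
  have upd_E: "x(i := y) \<in> E \<longleftrightarrow> x(i := y0) \<in> E"
    if "x \<in> space (PiM ?J M)" "y \<in> space (M i)" for x y
    using inv[OF upd[OF that(1) y0] that(2)] by simp
  have m: "(\<lambda>x. x(i := y0)) \<in> measurable (PiM ?J M) (PiM J M)"
    using y0 i by (intro measurable_fun_upd[where J = ?J]) auto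
  \<comment> \<open>Taking \<open>A = space (M i)\<close> later recovers the measure of
    \<open>E\<close> itself.\<close>
  have fact: "emeasure (PiM J M) {x \<in> E. x i \<in> A}
      = (\<integral>\<^sup>+x. indicator E (x(i := y0)) \<partial>PiM ?J M) * emeasure (M i) A" if A: "A \<in> sets (M i)" for A
  proof -
    have "{x \<in> E. x i \<in> A} = E \<inter> ((\<lambda>x. x i) -` A \<inter> space (PiM J M))"
      using sets.sets_into_space[OF E] by auto
    then have EA: "{x \<in> E. x i \<in> A} \<in> sets (PiM J M)"
      using E measurable_sets[OF measurable_component_singleton[OF i, of M] A] by (auto intro: sets.Int)
    have "emeasure (PiM J M) {x \<in> E. x i \<in> A}
        = (\<integral>\<^sup>+x. indicator {x \<in> E. x i \<in> A} x \<partial>PiM (insert i ?J) M)"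
      using EA unfolding J by simp
    also have "\<dots> = (\<integral>\<^sup>+x. \<integral>\<^sup>+y. indicator {x \<in> E. x i \<in> A} (x(i := y)) \<partial>M i \<partial>PiM ?J M)"
      using fin EA J by (intro product_nn_integral_insert) auto
    also have "\<dots> = (\<integral>\<^sup>+x. indicator E (x(i := y0)) * emeasure (M i) A \<partial>PiM ?J M)"
    proof (rule nn_integral_cong)
      fix x assume x: "x \<in> space (PiM ?J M)"
      have "(\<integral>\<^sup>+y. indicator {x \<in> E. x i \<in> A} (x(i := y)) \<partial>M i)
          = (\<integral>\<^sup>+y. indicator E (x(i := y0)) * indicator A y \<partial>M i)"
        using upd_E[OF x] by (intro nn_integral_cong) (auto simp: indicator_def)
      also have "\<dots> = indicator E (x(i := y0)) * emeasure (M i) A"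
        using A by (simp add: nn_integral_cmult)
      finally show "(\<integral>\<^sup>+y. indicator {x \<in> E. x i \<in> A} (x(i := y)) \<partial>M i)
          = indicator E (x(i := y0)) * emeasure (M i) A" .
    qed
    also have "\<dots> = (\<integral>\<^sup>+x. indicator E (x(i := y0)) \<partial>PiM ?J M) * emeasure (M i) A"
      using E by (intro nn_integral_multc measurable_compose[OF m]) auto
    finally show ?thesis .
  qed
  have "{x \<in> E. x i \<in> space (M i)} = E"
    using sets.sets_into_space[OF E] i by (auto simp: space_PiM)
  then have "emeasure (PiM J M) E = (\<integral>\<^sup>+x. indicator E (x(i := y0)) \<partial>PiM ?J M)"
    using fact[of "space (M i)"] by (simp add: prob_space.emeasure_space_1[OF prob])
  then show ?thesis using fact[OF B] by simp
qed

section \<open>The expected number of queries\<close>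

lemma competitive_on_greedy:
  assumes valid: "valid_instance I" and D: "value_distributions I D" and tau: "tau I D > 0"
  shows "competitive_on greedy I D
    (2 / tau I D * rho_trunc (2 / s_min I) (card (family I)) (b_max I))"
proof -
  let ?n = "n_ivls I" and ?P = "joint I D"
  let ?r = "rho_trunc (2 / s_min I) (card (family I)) (b_max I)"
  \<comment> \<open>Indices beyond the instance receive a point mass, so that every factor is a
    probability space.\<close>
  define D' where "D' = (\<lambda>i. if i < ?n then D i else return borel 0)"
  let ?B = "\<lambda>i. {x. (upper I i + lower I i) / 2 \<le> x}"
  have P: "?P = PiM {..<?n} D'" unfolding joint_def by (rule PiM_cong) (auto simp: D'_def)
  have prob: "prob_space (D' i)" for i
    using D by (auto simp: D'_def value_distributions_def intro: prob_space_return)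
  interpret P: prob_space ?P
    unfolding P using prob by (intro prob_space_PiM)
  have coord: "(\<lambda>w. w i) \<in> borel_measurable ?P" for i
    unfolding joint_def using D by (intro measurable_PiM_coordinate) (auto simp: value_distributions_def)
  note [measurable] = coord pred_queried[OF coord valid] measurable_OPT[OF coord valid]
  let ?Q = "\<lambda>i. {w \<in> space ?P. i \<in> queried greedy I w}"
  let ?H = "\<lambda>i. {w \<in> ?Q i. w i \<in> ?B i}"
  have Q: "?Q i \<in> sets ?P" for i by measurable
  have H: "?H i \<in> sets ?P" for i by measurable
  have queried_le: "i < ?n" if "i \<in> queried greedy I w" for i w
    using that run_distinct[of I w ?n] by (auto simp: queried_greedy)
  \<comment> \<open>By \<open>mem_run_cong\<close> the event of querying \<open>i\<close> ignores
    \<open>w i\<close>, so a success at \<open>i\<close> has the product probability.\<close>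
  have step: "tau I D * measure ?P (?Q i) \<le> measure ?P (?H i)" if i: "i < ?n" for i
  proof -
    have B: "?B i \<in> sets (D' i)" using D i by (simp add: D'_def value_distributions_def)
    have "emeasure ?P (?H i) = emeasure ?P (?Q i) * emeasure (D' i) (?B i)"
      unfolding P
    proof (rule emeasure_PiM_indep_component[where M = D', OF prob _ _ _ B])
      fix x y assume x: "x \<in> space (PiM {..<?n} D')" and y: "y \<in> space (D' i)"
      have "x(i := y) \<in> space (PiM {..<?n} D')"
        using x y i by (auto simp: space_PiM PiE_iff extensional_def)
      moreover have "i \<in> queried greedy I (x(i := y)) \<longleftrightarrow> i \<in> queried greedy I x"
        unfolding queried_greedy by (rule mem_run_cong) simp
      ultimately show "x(i := y) \<in> {w \<in> space (PiM {..<?n} D'). i \<in> queried greedy I w} \<longleftrightarrow>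
          x \<in> {w \<in> space (PiM {..<?n} D'). i \<in> queried greedy I w}"
        using x by simp
    qed (use i Q[of i] P in auto)
    then have "measure ?P (?H i) = measure ?P (?Q i) * measure (D i) (?B i)"
      using i by (simp add: D'_def measure_def enn2real_mult)
    moreover have "tau I D \<le> measure (D i) (?B i)"
      unfolding tau_def using i by (intro Min_le image_eqI[where x = i] refl) auto
    ultimately show ?thesis
      by (simp only: mult.commute[of "measure ?P (?Q i)"] mult_right_mono measure_nonneg)
  qed
  \<comment> \<open>Written as sums of indicators, the counts of queries and successes have sums of
    probabilities as expectations.\<close>
  have ALG: "real (ALG greedy I w) = (\<Sum>i<?n. indicator (?Q i) w)" if "w \<in> space ?P" for w
  proof -
    have "{..<?n} \<inter> queried greedy I w = queried greedy I w" using queried_le by auto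
    then show ?thesis using that
      by (simp add: ALG_greedy_eq_card indicator_def of_bool_def[symmetric] del: of_bool_def)
  qed
  have succ: "real (card {i \<in> queried greedy I w. (upper I i + lower I i) / 2 \<le> w i})
      = (\<Sum>i<?n. indicator (?H i) w)" if "w \<in> space ?P" for w
  proof -
    have "{..<?n} \<inter> {i. i \<in> queried greedy I w \<and> (upper I i + lower I i) / 2 \<le> w i}
        = {i \<in> queried greedy I w. (upper I i + lower I i) / 2 \<le> w i}" using queried_le by auto
    then show ?thesis using that
      by (simp add: indicator_def of_bool_def[symmetric] del: of_bool_def)
  qed
  have intQ: "integrable ?P (indicator (?Q i) :: _ \<Rightarrow> real)" for i
    using Q[of i] by (intro integrable_real_indicator) (simp_all add: P.emeasure_eq_measure)
  have intH: "integrable ?P (indicator (?H i) :: _ \<Rightarrow> real)" for i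
    using H[of i] by (intro integrable_real_indicator) (simp_all add: P.emeasure_eq_measure)
  have int_ALG: "integrable ?P (\<lambda>w. real (ALG greedy I w))"
    by (subst Bochner_Integration.integrable_cong[OF refl ALG]) (auto intro: intQ)
  have E_ALG: "(\<integral>w. real (ALG greedy I w) \<partial>?P) = (\<Sum>i<?n. measure ?P (?Q i))"
    using intQ Q by (subst Bochner_Integration.integral_cong[OF refl ALG]) auto
  have E_succ: "(\<integral>w. (\<Sum>i<?n. indicator (?H i) w) \<partial>?P) = (\<Sum>i<?n. measure ?P (?H i))"
    using intH H by auto
  \<comment> \<open>Values lie in their intervals only almost surely, so the bound per realization
    holds almost everywhere.\<close>
  have "AE w in ?P. \<forall>i\<in>{..<?n}. w i \<in> uncertainty_interval I i"
    unfolding joint_def using D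
    by (intro AE_finite_allI AE_PiM_component) (auto simp: value_distributions_def)
  then have AE_real: "AE w in ?P. realized_instance I w"
    by eventually_elim (use valid in \<open>auto simp: realized_instance_def realizations_def\<close>)
  \<comment> \<open>Integrability of \<open>OPT\<close> is required for the monotonicity of the
    integral below.\<close>
  have int_OPT: "integrable ?P (\<lambda>w. real (OPT I w))"
  proof (rule P.integrable_const_bound)
    show "AE w in ?P. norm (real (OPT I w)) \<le> real ?n"
      using AE_real by eventually_elim (simp add: realized_instance.OPT_le)
  qed simp
  have "tau I D * (\<integral>w. real (ALG greedy I w) \<partial>?P) \<le> (\<Sum>i<?n. measure ?P (?H i))"
    unfolding E_ALG sum_distrib_left using step by (intro sum_mono) auto
  also have "\<dots> \<le> (\<integral>w. 2 * ?r * real (OPT I w) \<partial>?P)"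
    unfolding E_succ[symmetric]
  proof (rule integral_mono_AE)
    show "AE w in ?P. (\<Sum>i<?n. indicator (?H i) w) \<le> 2 * ?r * real (OPT I w)"
      using AE_real AE_space
    proof eventually_elim
      case (elim w)
      then show ?case
        using realized_instance.successes_le_OPT[of I w] unfolding succ[OF elim(2)] by simp
    qed
  qed (use intH int_OPT in auto)
  also have "\<dots> = 2 * ?r * (\<integral>w. real (OPT I w) \<partial>?P)" by simp
  finally have "(\<integral>w. real (ALG greedy I w) \<partial>?P) \<le> 2 / tau I D * ?r * (\<integral>w. real (OPT I w) \<partial>?P)"
    using tau by (simp add: field_simps)
  then show ?thesis using int_ALG by (simp add: competitive_on_def)
qed

section \<open>Comparison of the two factors and asymptotics\<close>

lemma rho_eq_rho_trunc:
  assumes "\<lceil>ln (\<gamma> * real m * b)\<rceil> \<ge> 0" "rho \<gamma> m b \<ge> 1"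
  shows "rho \<gamma> m b = rho_trunc \<gamma> m b"
  using assms by (simp add: rho_def rho_trunc_def)

text \<open>The product filter sends \<open>m\<close> to infinity uniformly in
  \<open>\<tau>\<close>, so the constant depends on \<open>s\<close> and \<open>b\<close>
  alone.\<close>

lemma rho_bigo:
  assumes s: "s > 0" and b: "b > 0"
  shows "(\<lambda>(m, \<tau>). 2 / \<tau> * rho (2 / s) m b)
    \<in> O[sequentially \<times>\<^sub>F principal {0<..1}](\<lambda>(m, \<tau>). 1 / \<tau> * ln (real m))"
proof (rule bigoI)
  let ?c = "2 * (\<bar>ln (2 / s * b)\<bar> + 4)"
  \<comment> \<open>From \<open>m \<ge> 3\<close>, which exceeds \<open>exp 1\<close>, one has
    \<open>ln m \<ge> 1\<close>. The two ceilings add at most 2, and this and the constant logarithm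
    are absorbed by \<open>ln m\<close>.\<close>
  have key: "\<bar>rho (2 / s) m b\<bar> \<le> (\<bar>ln (2 / s * b)\<bar> + 4) * ln (real m)" if m: "m \<ge> 3" for m
  proof -
    have "3 \<le> real m" using m by simp
    then have "exp 1 \<le> real m" using exp_le by linarith
    then have ln: "ln (real m) \<ge> 1" using m by (subst ln_ge_iff) auto
    have "2 / s * real m * b = 2 / s * b * real m" by simp
    then have eq: "ln (2 / s * real m * b) = ln (2 / s * b) + ln (real m)"
      using s b m by (simp only:) (subst ln_mult_pos, auto)
    have "\<bar>rho (2 / s) m b\<bar> \<le> \<bar>ln (2 / s * b)\<bar> + 2 * ln (real m) + 2"
      unfolding rho_def eq using ln by linarith
    also have "\<dots> \<le> \<bar>ln (2 / s * b)\<bar> * ln (real m) + 4 * ln (real m)"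
      using ln mult_left_mono[OF ln, of "\<bar>ln (2 / s * b)\<bar>"] by linarith
    finally show ?thesis by (simp add: algebra_simps)
  qed
  have "eventually (\<lambda>\<tau>. \<tau> > 0) (principal {0<..1::real})"
    by (simp add: eventually_principal)
  from eventually_prodI[OF eventually_ge_at_top[of "3::nat"] this]
  show "eventually (\<lambda>x. norm (case x of (m, \<tau>) \<Rightarrow> 2 / \<tau> * rho (2 / s) m b)
      \<le> ?c * norm (case x of (m, \<tau>) \<Rightarrow> 1 / \<tau> * ln (real m)))
      (sequentially \<times>\<^sub>F principal {0<..1})"
  proof eventually_elim
    case (elim x)
    obtain m \<tau> where x: "x = (m, \<tau>)" by fastforce
    then have m: "m \<ge> 3" and t: "\<tau> > 0" using elim by auto
    have "2 / \<tau> * \<bar>rho (2 / s) m b\<bar> \<le> 2 / \<tau> * ((\<bar>ln (2 / s * b)\<bar> + 4) * ln (real m))"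
      using key[OF m] t by (intro mult_left_mono) auto
    also have "\<dots> = ?c * (1 / \<tau> * ln (real m))" by simp
    finally show ?case using t m by (simp add: x abs_mult)
  qed
qed

theorem theorem7:
  "(\<exists>A. query_algorithm A \<and>
      (\<forall>I. valid_instance I \<longrightarrow>
         (\<forall>w\<in>realizations I. is_solution I w (queried A I w)) \<and>
         (\<forall>D \<gamma>. value_distributions I D \<and> tau I D > 0 \<and> \<gamma> = 2 / s_min I \<longrightarrow>
            (\<lceil>ln (\<gamma> * real (card (family I)) * b_max I)\<rceil> \<ge> 0 \<and>
               rho \<gamma> (card (family I)) (b_max I) \<ge> 1 \<longrightarrow>
             competitive_on A I D (2 / tau I D * rho \<gamma> (card (family I)) (b_max I))) \<and>
            competitive_on A I D (2 / tau I D * rho_trunc \<gamma> (card (family I)) (b_max I))))) \<and>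
   (\<forall>s>0. \<forall>b>0.
      (\<lambda>(m, \<tau>). 2 / \<tau> * rho (2 / s) m b)
        \<in> O[sequentially \<times>\<^sub>F principal {0<..1}](\<lambda>(m, \<tau>). 1 / \<tau> * ln (real m)))"
proof (intro conjI exI[of _ greedy] query_algorithm_greedy allI impI ballI)
  fix I w assume "valid_instance I" "w \<in> realizations I"
  then show "is_solution I w (queried greedy I w)"
    by (intro realized_instance.is_solution_queried) (simp add: realized_instance_def)
next
  fix I D \<gamma>
  assume "valid_instance I" "value_distributions I D \<and> tau I D > 0 \<and> \<gamma> = 2 / s_min I"
  then show *: "competitive_on greedy I D (2 / tau I D * rho_trunc \<gamma> (card (family I)) (b_max I))"
    using competitive_on_greedy by simp
  assume "\<lceil>ln (\<gamma> * real (card (family I)) * b_max I)\<rceil> \<ge> 0 \<and> rho \<gamma> (card (family I)) (b_max I) \<ge> 1"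
  then show "competitive_on greedy I D (2 / tau I D * rho \<gamma> (card (family I)) (b_max I))"
    using * rho_eq_rho_trunc by metis
qed (rule rho_bigo)

end
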